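(* Let $\mathbf{k}$ be a commutative ring and $q\in\mathbf{k}$. Let $p\in\mathbf{k}$ be such that $pq=1$. Let $\alpha\in\mathrm{Comp}$. Then the antipode $S$ of $\mathrm{QSym}$ satisfies $$S\left(\eta_\alpha^{(q)}\right)=(-q)^{\ell(\alpha)}\,\eta_{\mathrm{rev}\,\alpha}^{(p)}.$$
   Context: For an integer $m$, $[m]=\{1,2,\ldots,m\}$ (empty if $m\le 0$). A composition is a finite tuple $\alpha=(\alpha_1,\ldots,\alpha_k)$ of positive integers; its length is $\ell(\alpha)=k$, its size is $|\alpha|=\alpha_1+\cdots+\alpha_k$. $\mathrm{Comp}$ is the set of all compositions (including the empty one), and $\mathrm{Comp}_n$ the set of compositions of size $n$. For $\alpha=(\alpha_1,\ldots,\alpha_k)\in\mathrm{Comp}_n$ set $D(\alpha)=\{\alpha_1+\cdots+\alpha_i \mid i\in[k-1]\}\subseteq[n-1]$. The reversal of $\alpha=(\alpha_1,\alpha_2,\ldots,\alpha_k)$ is $\mathrm{rev}\,\alpha=(\alpha_k,\alpha_{k-1},\ldots,\alpha_1)$. $\mathrm{QSym}$ is the Hopf algebra of quasisymmetric functions over $\mathbf{k}$ (a $\mathbf{k}$-subalgebra of $\mathbf{k}[[x_1,x_2,\ldots]]$). It has the $\mathbf{k}$-basis $(M_\alpha)_{\alpha\in\mathrm{Comp}}$ with $M_\alpha=\sum_{i_1<i_2<\cdots<i_\ell}x_{i_1}^{\alpha_1}\cdots x_{i_\ell}^{\alpha_\ell}$ for $\alpha=(\alpha_1,\ldots,\alpha_\ell)$.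 Its antipode is the $\mathbf{k}$-linear map $S:\mathrm{QSym}\to\mathrm{QSym}$ given by $S(M_\alpha)=(-1)^{\ell(\alpha)}\sum_{\gamma\in\mathrm{Comp}_n;\ D(\gamma)\subseteq D(\mathrm{rev}\,\alpha)}M_\gamma$ for all $n\in\{0,1,2,\ldots\}$ and $\alpha\in\mathrm{Comp}_n$. For any $c\in\mathbf{k}$ and any $\alpha\in\mathrm{Comp}_n$, $\eta_\alpha^{(c)}=\sum_{\beta\in\mathrm{Comp}_n;\ D(\beta)\subseteq D(\alpha)}(c+1)^{\ell(\beta)}M_\beta\in\mathrm{QSym}$. *)

theory Defs
  imports
    "HOL-Library.Poly_Mapping"
    "HOL-Library.Function_Algebras"
begin

section \<open>Compositions\<close>

definition Comp :: "nat list set" where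
  "Comp = {\<alpha>. \<forall>a\<in>set \<alpha>. 0 < a}"

definition Comp_of_size :: "nat \<Rightarrow> nat list set" where
  "Comp_of_size n = {\<alpha> \<in> Comp. sum_list \<alpha> = n}"

definition D :: "nat list \<Rightarrow> nat set" where
  "D \<alpha> = {sum_list (take i \<alpha>) | i. i \<in> {1..<length \<alpha>}}"


section \<open>Power series in countably many variables\<close>

text \<open>
  Exponent vectors of monomials are finitely supported functions
  \<^typ>\<open>nat \<Rightarrow>\<^sub>0 nat\<close>, and a formal power series is its coefficient function. The
  variables are indexed from 0. Addition of power series and finite sums of them
  are the pointwise ones of \<^theory>\<open>HOL-Library.Function_Algebras\<close>. The pointwise
  product from that theory is not the product of power series; it is never used.

  The sort \<open>{comm_ring, comm_monoid_mult}\<close> is that of commutative rings with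
  unity. Unlike \<^class>\<open>comm_ring_1\<close>, it does not exclude the zero ring.
\<close>

type_synonym 'k power_series = "(nat \<Rightarrow>\<^sub>0 nat) \<Rightarrow> 'k"

definition scale :: "'k::{comm_ring, comm_monoid_mult} \<Rightarrow> 'k power_series \<Rightarrow> 'k power_series"
    (infixr "\<odot>" 75) where
  "c \<odot> f = (\<lambda>\<mu>. c * f \<mu>)"

definition mdegree :: "(nat \<Rightarrow>\<^sub>0 nat) \<Rightarrow> nat" where
  "mdegree \<mu> = (\<Sum>i\<in>Poly_Mapping.keys \<mu>. Poly_Mapping.lookup \<mu> i)"

text \<open>The exponent vector of $x_{i_1}^{\alpha_1} \cdots x_{i_l}^{\alpha_l}$.\<close>

definition expo :: "nat list \<Rightarrow> nat list \<Rightarrow> (nat \<Rightarrow>\<^sub>0 nat)" where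
  "expo is \<alpha> = sum_list (map2 Poly_Mapping.single is \<alpha>)"

definition incr_seqs :: "nat \<Rightarrow> nat list set" where
  "incr_seqs l = {is. length is = l \<and> sorted_wrt (<) is}"


section \<open>Quasisymmetric functions\<close>

definition QSym :: "'k::{comm_ring, comm_monoid_mult} power_series set" where
  "QSym = {f. (\<exists>d. \<forall>\<mu>. f \<mu> \<noteq> 0 \<longrightarrow> mdegree \<mu> \<le> d) \<and>
     (\<forall>\<alpha>\<in>Comp. \<forall>is\<in>incr_seqs (length \<alpha>). \<forall>js\<in>incr_seqs (length \<alpha>).
        f (expo is \<alpha>) = f (expo js \<alpha>))}"

text \<open>
  The sum of $x_{i_1}^{\alpha_1} \cdots x_{i_l}^{\alpha_l}$ over
  $i_1 < \cdots < i_l$, taken coefficientwise: for a composition \<open>\<alpha>\<close> only finitely many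
  (in fact at most one) of the index sequences contribute to a given monomial.
\<close>

definition M :: "nat list \<Rightarrow> 'k::{comm_ring, comm_monoid_mult} power_series" where
  "M \<alpha> = (\<lambda>\<mu>. \<Sum>is\<in>{is \<in> incr_seqs (length \<alpha>). expo is \<alpha> = \<mu>}. 1)"

text \<open>The coordinate of a quasisymmetric function at \<^term>\<open>M \<alpha>\<close>; see \<open>QSym_expansion\<close>.\<close>

definition M_coeff :: "'k::{comm_ring, comm_monoid_mult} power_series \<Rightarrow> nat list \<Rightarrow> 'k" where
  "M_coeff f \<alpha> = f (expo [0..<length \<alpha>] \<alpha>)"

definition antipode_M :: "nat list \<Rightarrow> 'k::{comm_ring, comm_monoid_mult} power_series" where
  "antipode_M \<alpha> =
     (- 1) ^ length \<alpha> \<odot> (\<Sum>\<gamma>\<in>{\<gamma> \<in> Comp_of_size (sum_list \<alpha>). D \<gamma> \<subseteq> D (rev \<alpha>)}. M \<gamma>)"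

text \<open>
  The linear extension of \<^const>\<open>antipode_M\<close> from the basis \<^const>\<open>M\<close> to
  \<^const>\<open>QSym\<close>, on which the sum is finite. The values outside of \<^const>\<open>QSym\<close> are
  meaningless. The lemmas \<open>antipode_in_QSym\<close>, \<open>antipode_add\<close>, \<open>antipode_scale\<close>,
  \<open>antipode_basis\<close> and \<open>antipode_unique\<close> below say that on \<^const>\<open>QSym\<close> this is the unique
  linear map with the prescribed values on the basis.
\<close>

definition antipode :: "'k::{comm_ring, comm_monoid_mult} power_series \<Rightarrow> 'k power_series" where
  "antipode f = (\<Sum>\<alpha>\<in>{\<alpha> \<in> Comp. M_coeff f \<alpha> \<noteq> 0}. M_coeff f \<alpha> \<odot> antipode_M \<alpha>)"

definition \<eta> :: "'k::{comm_ring, comm_monoid_mult} \<Rightarrow> nat list \<Rightarrow> 'k power_series" where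
  "\<eta> c \<alpha> = (\<Sum>\<beta>\<in>{\<beta> \<in> Comp_of_size (sum_list \<alpha>). D \<beta> \<subseteq> D \<alpha>}. (c + 1) ^ length \<beta> \<odot> M \<beta>)"


section \<open>Basic facts\<close>

lemma scale_apply [simp]: "(c \<odot> f) \<mu> = c * f \<mu>"
  by (simp add: scale_def)

lemma sum_fun_apply: "(\<Sum>a\<in>A. f a) x = (\<Sum>a\<in>A. f a x)"
  by (induction A rule: infinite_finite_induct) auto

lemma expo_Nil [simp]: "expo [] \<alpha> = 0" "expo is [] = 0"
  by (simp_all add: expo_def)

lemma expo_Cons [simp]: "expo (i # is) (a # \<alpha>) = Poly_Mapping.single i a + expo is \<alpha>"
  by (simp add: expo_def)

lemma lookup_expo_notin:
  "i \<notin> set is \<Longrightarrow> Poly_Mapping.lookup (expo is \<alpha>) i = 0"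
proof (induction "is" \<alpha> rule: list_induct2')
  case (4 x xs y ys)
  then show ?case by (auto simp: lookup_add lookup_single)
qed auto

lemma map_lookup_expo:
  "length is = length \<alpha> \<Longrightarrow> distinct is \<Longrightarrow> map (Poly_Mapping.lookup (expo is \<alpha>)) is = \<alpha>"
proof (induction "is" \<alpha> rule: list_induct2)
  case (Cons x xs y ys)
  have "map (Poly_Mapping.lookup (expo (x # xs) (y # ys))) xs
      = map (Poly_Mapping.lookup (expo xs ys)) xs"
    using Cons by (intro map_cong) (auto simp: lookup_add lookup_single when_def)
  moreover have "Poly_Mapping.lookup (expo (x # xs) (y # ys)) x = y"
    using Cons by (simp add: lookup_add lookup_single lookup_expo_notin)
  moreover have "map (Poly_Mapping.lookup (expo xs ys)) xs = ys"
    using Cons by simp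
  ultimately show ?case by (simp only: list.map)
qed simp

lemma keys_expo:
  assumes "length is = length \<alpha>" "distinct is" "\<alpha> \<in> Comp"
  shows "Poly_Mapping.keys (expo is \<alpha>) = set is"
proof -
  have "Poly_Mapping.lookup (expo is \<alpha>) i \<noteq> 0" if "i \<in> set is" for i
  proof -
    have "Poly_Mapping.lookup (expo is \<alpha>) i \<in> set (map (Poly_Mapping.lookup (expo is \<alpha>)) is)"
      using that by simp
    then have "Poly_Mapping.lookup (expo is \<alpha>) i \<in> set \<alpha>"
      unfolding map_lookup_expo[OF assms(1,2)] .
    then show ?thesis using assms(3) by (auto simp: Comp_def)
  qed
  then have "i \<in> Poly_Mapping.keys (expo is \<alpha>) \<longleftrightarrow> i \<in> set is" for i
    using lookup_expo_notin[of i "is" \<alpha>] by (cases "i \<in> set is") (auto simp: in_keys_iff)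
  then show ?thesis by blast
qed

lemma incr_seqs_distinct: "is \<in> incr_seqs l \<Longrightarrow> distinct is \<and> length is = l"
  by (auto simp: incr_seqs_def strict_sorted_iff)

lemma expo_inj:
  assumes "\<alpha> \<in> Comp" "\<beta> \<in> Comp" "is \<in> incr_seqs (length \<alpha>)" "js \<in> incr_seqs (length \<beta>)"
    and eq: "expo is \<alpha> = expo js \<beta>"
  shows "is = js \<and> \<alpha> = \<beta>"
proof -
  have d: "distinct is" "length is = length \<alpha>" "distinct js" "length js = length \<beta>"
    using assms incr_seqs_distinct by auto
  have "set is = set js"
    using keys_expo[OF d(2,1) assms(1)] keys_expo[OF d(4,3) assms(2)] eq by simp
  then have "is = js"
    using assms(3,4) by (intro strict_sorted_equal) (auto simp: incr_seqs_def)
  moreover have "\<alpha> = \<beta>"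
    using map_lookup_expo[OF d(2,1)] map_lookup_expo[OF d(4,3)] eq \<open>is = js\<close> by metis
  ultimately show ?thesis by simp
qed

lemma expo_surj:
  obtains "is" \<alpha> where "\<alpha> \<in> Comp" "is \<in> incr_seqs (length \<alpha>)" "\<mu> = expo is \<alpha>"
proof -
  define js where "js = sorted_list_of_set (Poly_Mapping.keys \<mu>)"
  define \<alpha> where "\<alpha> = map (Poly_Mapping.lookup \<mu>) js"
  have js: "set js = Poly_Mapping.keys \<mu>" "distinct js" "sorted_wrt (<) js"
    by (simp_all add: js_def)
  have C: "\<alpha> \<in> Comp"
    using js(1) by (auto simp: \<alpha>_def Comp_def in_keys_iff)
  have I: "js \<in> incr_seqs (length \<alpha>)"
    using js by (simp add: incr_seqs_def \<alpha>_def)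
  have m: "map (Poly_Mapping.lookup (expo js \<alpha>)) js = map (Poly_Mapping.lookup \<mu>) js"
    using map_lookup_expo[of js \<alpha>] js by (simp add: \<alpha>_def)
  have "\<mu> = expo js \<alpha>"
  proof (rule poly_mapping_eqI)
    fix i
    show "Poly_Mapping.lookup \<mu> i = Poly_Mapping.lookup (expo js \<alpha>) i"
    proof (cases "i \<in> set js")
      case True
      then show ?thesis using m by (simp add: map_eq_conv)
    next
      case False
      then show ?thesis using js(1) by (simp add: lookup_expo_notin in_keys_iff)
    qed
  qed
  then show ?thesis using C I that by blast
qed

lemma mdegree_expo:
  assumes "length is = length \<alpha>" "distinct is" "\<alpha> \<in> Comp"
  shows "mdegree (expo is \<alpha>) = sum_list \<alpha>"
  using sum_list_distinct_conv_sum_set[OF assms(2), of "Poly_Mapping.lookup (expo is \<alpha>)"]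
  by (simp add: mdegree_def keys_expo[OF assms] map_lookup_expo[OF assms(1,2)])

lemma M_expo:
  assumes "\<alpha> \<in> Comp" "\<beta> \<in> Comp" "is \<in> incr_seqs (length \<beta>)"
  shows "M \<alpha> (expo is \<beta>) = (if \<alpha> = \<beta> then 1 else 0)"
proof -
  have "{js \<in> incr_seqs (length \<alpha>). expo js \<alpha> = expo is \<beta>} = (if \<alpha> = \<beta> then {is} else {})"
    using expo_inj[OF assms(1,2) _ assms(3)] assms(3) by auto
  then show ?thesis by (simp add: M_def)
qed

lemma upt_incr [simp]: "[0..<l] \<in> incr_seqs l"
  by (simp add: incr_seqs_def)

lemma M_coeff_M:
  "\<alpha> \<in> Comp \<Longrightarrow> \<beta> \<in> Comp \<Longrightarrow> M_coeff (M \<alpha>) \<beta> = (if \<alpha> = \<beta> then 1 else 0)"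
  by (simp add: M_coeff_def M_expo)

lemma M_in_QSym:
  assumes "\<alpha> \<in> Comp"
  shows "(M \<alpha> :: 'k::{comm_ring, comm_monoid_mult} power_series) \<in> QSym"
proof -
  have "mdegree \<mu> \<le> sum_list \<alpha>" if "M \<alpha> \<mu> \<noteq> (0::'k)" for \<mu>
  proof -
    obtain "is" \<beta> where *: "\<beta> \<in> Comp" "is \<in> incr_seqs (length \<beta>)" "\<mu> = expo is \<beta>"
      by (rule expo_surj)
    then have "\<alpha> = \<beta>"
      using that M_expo[OF assms *(1,2), where 'a = 'k] by (auto split: if_splits)
    then show ?thesis
      using * mdegree_expo[of "is" \<beta>] incr_seqs_distinct by auto
  qed
  then show ?thesis
    using assms by (auto simp: QSym_def M_expo)
qed

lemma QSym_0: "0 \<in> QSym"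
  by (simp add: QSym_def)

lemma QSymI:
  assumes "\<And>\<mu>. f \<mu> \<noteq> 0 \<Longrightarrow> mdegree \<mu> \<le> d"
    and "\<And>\<alpha> is js. \<alpha> \<in> Comp \<Longrightarrow> is \<in> incr_seqs (length \<alpha>) \<Longrightarrow> js \<in> incr_seqs (length \<alpha>) \<Longrightarrow>
           f (expo is \<alpha>) = f (expo js \<alpha>)"
  shows "f \<in> QSym"
  using assms unfolding QSym_def by blast

lemma QSym_degree:
  assumes "f \<in> QSym"
  obtains d where "\<And>\<mu>. f \<mu> \<noteq> 0 \<Longrightarrow> mdegree \<mu> \<le> d"
  using assms unfolding QSym_def by blast

lemma QSym_expo:
  "f \<in> QSym \<Longrightarrow> \<alpha> \<in> Comp \<Longrightarrow> is \<in> incr_seqs (length \<alpha>) \<Longrightarrow> js \<in> incr_seqs (length \<alpha>) \<Longrightarrow>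
    f (expo is \<alpha>) = f (expo js \<alpha>)"
  unfolding QSym_def by blast

lemma QSym_scale:
  assumes "f \<in> QSym"
  shows "c \<odot> f \<in> QSym"
proof -
  obtain d where d: "\<And>\<mu>. f \<mu> \<noteq> 0 \<Longrightarrow> mdegree \<mu> \<le> d"
    using QSym_degree[OF assms] by blast
  show ?thesis
  proof (rule QSymI)
    fix \<mu> assume "(c \<odot> f) \<mu> \<noteq> 0"
    then have "f \<mu> \<noteq> 0" by (metis scale_apply mult_zero_right)
    then show "mdegree \<mu> \<le> d" by (rule d)
  next
    fix \<alpha> "is" js
    assume "\<alpha> \<in> Comp" "is \<in> incr_seqs (length \<alpha>)" "js \<in> incr_seqs (length \<alpha>)"
    then show "(c \<odot> f) (expo is \<alpha>) = (c \<odot> f) (expo js \<alpha>)"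
      unfolding scale_apply using QSym_expo[OF assms] by metis
  qed
qed

lemma QSym_add:
  assumes "f \<in> QSym" "g \<in> QSym"
  shows "f + g \<in> QSym"
proof -
  obtain d where d: "\<And>\<mu>. f \<mu> \<noteq> 0 \<Longrightarrow> mdegree \<mu> \<le> d"
    using QSym_degree[OF assms(1)] by blast
  obtain e where e: "\<And>\<mu>. g \<mu> \<noteq> 0 \<Longrightarrow> mdegree \<mu> \<le> e"
    using QSym_degree[OF assms(2)] by blast
  show ?thesis
  proof (rule QSymI)
    fix \<mu> assume "(f + g) \<mu> \<noteq> 0"
    then have "f \<mu> \<noteq> 0 \<or> g \<mu> \<noteq> 0" by (metis plus_fun_apply add.right_neutral)
    then show "mdegree \<mu> \<le> max d e" using d e by (metis max.coboundedI1 max.coboundedI2)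
  next
    fix \<alpha> "is" js
    assume "\<alpha> \<in> Comp" "is \<in> incr_seqs (length \<alpha>)" "js \<in> incr_seqs (length \<alpha>)"
    then show "(f + g) (expo is \<alpha>) = (f + g) (expo js \<alpha>)"
      unfolding plus_fun_apply using QSym_expo[OF assms(1)] QSym_expo[OF assms(2)] by metis
  qed
qed

lemma QSym_sum: "(\<And>a. a \<in> A \<Longrightarrow> f a \<in> QSym) \<Longrightarrow> (\<Sum>a\<in>A. f a) \<in> QSym"
  by (induction A rule: infinite_finite_induct) (simp_all add: QSym_0 QSym_add)

lemma length_le_sum_list: "\<alpha> \<in> Comp \<Longrightarrow> length \<alpha> \<le> sum_list \<alpha>"
  by (induction \<alpha>) (auto simp: Comp_def)

lemma finite_Comp_le: "finite {\<alpha> \<in> Comp. sum_list \<alpha> \<le> n}"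
proof (rule finite_subset)
  show "{\<alpha> \<in> Comp. sum_list \<alpha> \<le> n} \<subseteq> {\<alpha>. set \<alpha> \<subseteq> {..n} \<and> length \<alpha> \<le> n}"
  proof safe
    fix \<alpha> a assume "\<alpha> \<in> Comp" "sum_list \<alpha> \<le> n"
    then show "length \<alpha> \<le> n" using length_le_sum_list[of \<alpha>] by linarith
    assume "a \<in> set \<alpha>"
    then show "a \<le> n" using member_le_sum_list[of a \<alpha>] \<open>sum_list \<alpha> \<le> n\<close> by linarith
  qed
  show "finite {\<alpha>. set \<alpha> \<subseteq> {..n} \<and> length \<alpha> \<le> n}"
    by (rule finite_lists_length_le) simp
qed

lemma finite_Comp_of_size: "finite (Comp_of_size n)"
  by (rule finite_subset[OF _ finite_Comp_le[of n]]) (auto simp: Comp_of_size_def)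

lemma finite_M_coeff:
  assumes "f \<in> QSym"
  shows "finite {\<alpha> \<in> Comp. M_coeff f \<alpha> \<noteq> 0}"
proof -
  obtain d where d: "\<And>\<mu>. f \<mu> \<noteq> 0 \<Longrightarrow> mdegree \<mu> \<le> d"
    using QSym_degree[OF assms] by blast
  have "{\<alpha> \<in> Comp. M_coeff f \<alpha> \<noteq> 0} \<subseteq> {\<alpha> \<in> Comp. sum_list \<alpha> \<le> d}"
  proof safe
    fix \<alpha> assume "\<alpha> \<in> Comp" "M_coeff f \<alpha> \<noteq> 0"
    then show "sum_list \<alpha> \<le> d"
      using d[of "expo [0..<length \<alpha>] \<alpha>"] mdegree_expo[of "[0..<length \<alpha>]" \<alpha>]
      by (simp add: M_coeff_def)
  qed
  then show ?thesis by (rule finite_subset[OF _ finite_Comp_le])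
qed

lemma QSym_expansion:
  assumes "f \<in> QSym"
  shows "f = (\<Sum>\<alpha>\<in>{\<alpha> \<in> Comp. M_coeff f \<alpha> \<noteq> 0}. M_coeff f \<alpha> \<odot> M \<alpha>)"
proof
  fix \<mu>
  obtain "is" \<beta> where *: "\<beta> \<in> Comp" "is \<in> incr_seqs (length \<beta>)" "\<mu> = expo is \<beta>"
    by (rule expo_surj)
  let ?A = "{\<alpha> \<in> Comp. M_coeff f \<alpha> \<noteq> 0}"
  have f\<mu>: "f \<mu> = M_coeff f \<beta>"
    unfolding M_coeff_def *(3) by (rule QSym_expo[OF assms *(1,2) upt_incr])
  have "(\<Sum>\<alpha>\<in>?A. M_coeff f \<alpha> \<odot> M \<alpha>) \<mu> = (\<Sum>\<alpha>\<in>?A. if \<alpha> = \<beta> then M_coeff f \<alpha> else 0)"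
    unfolding sum_fun_apply *(3) by (rule sum.cong) (auto simp: M_expo * cong: if_cong)
  also have "\<dots> = M_coeff f \<beta>"
    using finite_M_coeff[OF assms] * by (simp add: sum.delta)
  finally show "f \<mu> = (\<Sum>\<alpha>\<in>?A. M_coeff f \<alpha> \<odot> M \<alpha>) \<mu>"
    using f\<mu> by simp
qed

lemma \<eta>_in_QSym: "\<eta> c \<alpha> \<in> QSym"
  unfolding \<eta>_def by (intro QSym_sum QSym_scale M_in_QSym) (auto simp: Comp_of_size_def)

lemma antipode_in_QSym: "antipode f \<in> QSym"
  unfolding antipode_def antipode_M_def
  by (intro QSym_sum QSym_scale M_in_QSym) (auto simp: Comp_of_size_def)

lemma scale_0: "0 \<odot> f = 0"
  by (simp add: fun_eq_iff)

lemma antipode_eq_sum: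
  assumes "finite A" "A \<subseteq> Comp" "{\<alpha> \<in> Comp. M_coeff f \<alpha> \<noteq> 0} \<subseteq> A"
  shows "antipode f = (\<Sum>\<alpha>\<in>A. M_coeff f \<alpha> \<odot> antipode_M \<alpha>)"
  unfolding antipode_def using assms by (intro sum.mono_neutral_left) (auto simp: scale_0)

lemma antipode_scale:
  assumes "f \<in> QSym"
  shows "antipode (c \<odot> f) = c \<odot> antipode f"
proof -
  let ?A = "{\<alpha> \<in> Comp. M_coeff f \<alpha> \<noteq> 0}"
  have "antipode (c \<odot> f) = (\<Sum>\<alpha>\<in>?A. M_coeff (c \<odot> f) \<alpha> \<odot> antipode_M \<alpha>)"
    using finite_M_coeff[OF assms] by (intro antipode_eq_sum) (auto simp: M_coeff_def)
  also have "\<dots> = c \<odot> antipode f"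
    by (simp add: fun_eq_iff antipode_def sum_fun_apply sum_distrib_left M_coeff_def mult.assoc)
  finally show ?thesis .
qed

lemma antipode_add:
  assumes "f \<in> QSym" "g \<in> QSym"
  shows "antipode (f + g) = antipode f + antipode g"
proof -
  let ?A = "{\<alpha> \<in> Comp. M_coeff f \<alpha> \<noteq> 0} \<union> {\<alpha> \<in> Comp. M_coeff g \<alpha> \<noteq> 0}"
  have fin: "finite ?A" using finite_M_coeff assms by blast
  have "antipode h = (\<Sum>\<alpha>\<in>?A. M_coeff h \<alpha> \<odot> antipode_M \<alpha>)" if "h \<in> {f, g, f + g}" for h
    using that fin by (intro antipode_eq_sum) (auto simp: M_coeff_def)
  then show ?thesis
    by (simp add: fun_eq_iff sum_fun_apply M_coeff_def distrib_right sum.distrib)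
qed

lemma antipode_basis:
  assumes "\<alpha> \<in> Comp_of_size n"
  shows "antipode (M \<alpha>) =
    (- 1) ^ length \<alpha> \<odot> (\<Sum>\<gamma>\<in>{\<gamma> \<in> Comp_of_size n. D \<gamma> \<subseteq> D (rev \<alpha>)}. M \<gamma>)"
proof -
  have \<alpha>: "\<alpha> \<in> Comp" "sum_list \<alpha> = n" using assms by (auto simp: Comp_of_size_def)
  have "antipode (M \<alpha>) = (\<Sum>\<beta>\<in>{\<alpha>}. M_coeff (M \<alpha>) \<beta> \<odot> antipode_M \<beta>)"
    using \<alpha> by (intro antipode_eq_sum) (auto simp: M_coeff_M split: if_splits)
  also have "\<dots> = antipode_M \<alpha>" using \<alpha> by (simp add: M_coeff_M fun_eq_iff)
  finally show ?thesis using \<alpha> by (simp add: antipode_M_def)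
qed

lemma antipode_unique:
  fixes T :: "'k::{comm_ring, comm_monoid_mult} power_series \<Rightarrow> 'k power_series"
  assumes add: "\<And>f g. f \<in> QSym \<Longrightarrow> g \<in> QSym \<Longrightarrow> T (f + g) = T f + T g"
    and scale: "\<And>c f. f \<in> QSym \<Longrightarrow> T (c \<odot> f) = c \<odot> T f"
    and basis: "\<And>n \<alpha>. \<alpha> \<in> Comp_of_size n \<Longrightarrow> T (M \<alpha>) =
      (- 1) ^ length \<alpha> \<odot> (\<Sum>\<gamma>\<in>{\<gamma> \<in> Comp_of_size n. D \<gamma> \<subseteq> D (rev \<alpha>)}. M \<gamma>)"
    and f: "f \<in> QSym"
  shows "T f = antipode f"
proof -
  have T0: "T 0 = 0" using scale[OF QSym_0, of 0] by (simp add: scale_0)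
  have T_sum: "T (\<Sum>\<alpha>\<in>A. c \<alpha> \<odot> M \<alpha>) = (\<Sum>\<alpha>\<in>A. c \<alpha> \<odot> antipode_M \<alpha>)"
    if "finite A" "A \<subseteq> Comp" for A and c :: "nat list \<Rightarrow> 'k"
    using that
  proof (induction A rule: finite_induct)
    case (insert \<alpha> A)
    have "(\<Sum>\<alpha>\<in>A. c \<alpha> \<odot> M \<alpha>) \<in> QSym"
      using insert by (intro QSym_sum QSym_scale M_in_QSym) auto
    moreover have "T (M \<alpha>) = antipode_M \<alpha>"
      using basis[of \<alpha> "sum_list \<alpha>"] insert by (simp add: antipode_M_def Comp_of_size_def)
    moreover have "M \<alpha> \<in> (QSym :: 'k power_series set)"
      using insert by (intro M_in_QSym) auto
    ultimately have "T (c \<alpha> \<odot> M \<alpha> + (\<Sum>\<alpha>\<in>A. c \<alpha> \<odot> M \<alpha>))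
        = c \<alpha> \<odot> antipode_M \<alpha> + T (\<Sum>\<alpha>\<in>A. c \<alpha> \<odot> M \<alpha>)"
      using add[OF QSym_scale] scale by simp
    moreover have "T (\<Sum>\<alpha>\<in>A. c \<alpha> \<odot> M \<alpha>) = (\<Sum>\<alpha>\<in>A. c \<alpha> \<odot> antipode_M \<alpha>)"
      using insert by blast
    ultimately show ?case
      unfolding sum.insert[OF insert.hyps] by (rule trans[OF _ arg_cong])
  qed (simp only: sum.empty T0)
  have "T f = T (\<Sum>\<alpha>\<in>{\<alpha> \<in> Comp. M_coeff f \<alpha> \<noteq> 0}. M_coeff f \<alpha> \<odot> M \<alpha>)"
    by (rule arg_cong[OF QSym_expansion[OF f]])
  also have "\<dots> = antipode f"
    unfolding antipode_def by (rule T_sum[OF finite_M_coeff[OF f]]) auto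
  finally show ?thesis .
qed

end

theory Submission
  imports Defs
begin

text \<open>
  The identity is compared coefficient by coefficient at the basis elements \<^term>\<open>M \<gamma>\<close>. A
  composition of size \<open>n\<close> is the same thing as its set of partial sums, which is an arbitrary
  subset of \<open>{0..n}\<close> that contains \<open>0\<close> and \<open>n\<close> (\<open>partial_sums_inj\<close>,
  \<open>partial_sums_surj\<close>). Under this correspondence refinement becomes inclusion, the length
  becomes the cardinality minus one, and reversal becomes the reflection \<open>x \<mapsto> n - x\<close>.

  Let \<open>A\<close> and \<open>C\<close> be the sets of partial sums of \<open>\<alpha>\<close> and of \<open>rev \<gamma>\<close>. In
  \<open>S(\<eta>\<^sub>\<alpha>)\<close> the element \<^term>\<open>M \<gamma>\<close> receives a contribution from each \<open>\<beta>\<close>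
  whose set of partial sums \<open>B\<close> lies between \<open>C\<close> and \<open>A\<close>, namely
  \<open>(-(q + 1))\<close> to the power \<open>card B - 1\<close>. The binomial theorem in its subset form
  (\<open>sum_power_card_between\<close>, for compositions \<open>sum_power_length_between\<close>) collapses their sum to
  \<open>(-(q + 1))^(card C - 1) * (-q)^(card A - card C)\<close>, because \<open>1 - (q + 1) = -q\<close>.
  Finally \<open>pq = 1\<close> gives \<open>-(q + 1) = (-q)(p + 1)\<close>, so that this equals
  \<open>(-q)^(card A - 1) * (p + 1)^(card C - 1)\<close>, which is the coefficient of
  \<^term>\<open>M \<gamma>\<close> on the right-hand side.
\<close>

section \<open>Compositions as sets of partial sums\<close>

text \<open>
  Unlike \<^const>\<open>D\<close>, this includes the empty and the full sum. The empty composition then needs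
  no separate treatment, and the size can be read off as the maximum.
\<close>
definition partial_sums :: "nat list \<Rightarrow> nat set" where
  "partial_sums \<beta> = (\<lambda>i. sum_list (take i \<beta>)) ` {..length \<beta>}"

lemma partial_sums_Nil [simp]: "partial_sums [] = {0}"
  by (simp add: partial_sums_def)

lemma partial_sums_snoc:
  "partial_sums (\<beta> @ [a]) = insert (sum_list \<beta> + a) (partial_sums \<beta>)"
proof -
  have "(\<lambda>i. sum_list (take i (\<beta> @ [a]))) ` {..length \<beta>} = partial_sums \<beta>"
    unfolding partial_sums_def by (intro image_cong) auto
  then show ?thesis
    by (simp add: partial_sums_def atMost_Suc)
qed

lemma Comp_snoc [simp]: "\<beta> @ [a] \<in> Comp \<longleftrightarrow> \<beta> \<in> Comp \<and> 0 < a"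
  by (auto simp: Comp_def)

lemma rev_in_Comp [simp]: "rev \<beta> \<in> Comp \<longleftrightarrow> \<beta> \<in> Comp"
  by (simp add: Comp_def)

lemma finite_partial_sums [simp]: "finite (partial_sums \<beta>)"
  by (simp add: partial_sums_def)

lemma zero_in_partial_sums [simp]: "0 \<in> partial_sums \<beta>"
  by (force simp: partial_sums_def)

lemma sum_list_in_partial_sums [simp]: "sum_list \<beta> \<in> partial_sums \<beta>"
  by (force simp: partial_sums_def)

lemma partial_sums_le: "x \<in> partial_sums \<beta> \<Longrightarrow> x \<le> sum_list \<beta>"
  by (induction \<beta> rule: rev_induct) (auto simp: partial_sums_snoc)

lemma Max_partial_sums: "Max (partial_sums \<beta>) = sum_list \<beta>"
  by (intro Max_eqI) (simp_all add: partial_sums_le)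

lemma partial_sums_snoc_fresh:
  "0 < a \<Longrightarrow> sum_list \<beta> + a \<notin> partial_sums \<beta>"
  using partial_sums_le by fastforce

lemma card_partial_sums: "\<beta> \<in> Comp \<Longrightarrow> card (partial_sums \<beta>) = Suc (length \<beta>)"
  by (induction \<beta> rule: rev_induct) (simp_all add: partial_sums_snoc partial_sums_snoc_fresh)

text \<open>
  The maximum of the set recovers the size of the composition, and removing the maximum amounts to
  removing the last part.
\<close>
lemma partial_sums_inj:
  "\<beta> \<in> Comp \<Longrightarrow> \<gamma> \<in> Comp \<Longrightarrow> partial_sums \<beta> = partial_sums \<gamma> \<Longrightarrow> \<beta> = \<gamma>"
proof (induction \<beta> arbitrary: \<gamma> rule: rev_induct)
  case Nil
  then have "length \<gamma> = 0"
    using card_partial_sums[of \<gamma>] by (simp flip: Nil.prems(3))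
  then show ?case by simp
next
  case (snoc a \<beta>)
  have "length \<gamma> \<noteq> 0"
    using snoc.prems card_partial_sums[of \<gamma>] card_partial_sums[of "\<beta> @ [a]"] by simp
  then obtain \<delta> b where \<gamma>: "\<gamma> = \<delta> @ [b]"
    by (cases \<gamma> rule: rev_cases) auto
  have pos: "\<beta> \<in> Comp" "0 < a" "\<delta> \<in> Comp" "0 < b"
    using snoc.prems by (simp_all add: \<gamma>)
  have size: "sum_list \<beta> + a = sum_list \<delta> + b"
    using Max_partial_sums[of "\<beta> @ [a]"] Max_partial_sums[of \<gamma>] snoc.prems(3) by (simp add: \<gamma>)
  have "partial_sums \<beta> = partial_sums \<delta>"
    using snoc.prems(3) partial_sums_snoc_fresh[OF pos(2), of \<beta>]
      partial_sums_snoc_fresh[OF pos(4), of \<delta>]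
    unfolding \<gamma> partial_sums_snoc size by (simp add: insert_ident)
  then have "\<beta> = \<delta>"
    using snoc.IH pos by blast
  then show ?case
    using size \<gamma> by simp
qed

lemma partial_sums_surj:
  assumes "finite B" "0 \<in> B"
  shows "\<exists>\<beta>\<in>Comp. partial_sums \<beta> = B"
proof -
  have "\<exists>\<beta>\<in>Comp. partial_sums \<beta> = insert 0 B" if "finite B" for B
    using that
  proof (induction B rule: finite_linorder_max_induct)
    case empty
    then show ?case by (intro bexI[of _ "[]"]) (auto simp: Comp_def)
  next
    case (insert b B)
    then obtain \<beta> where \<beta>: "\<beta> \<in> Comp" "partial_sums \<beta> = insert 0 B" by blast
    show ?case
    proof (cases "b = 0")
      case True
      then show ?thesis using \<beta> by auto
    next
      case False
      then have "sum_list \<beta> < b"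
        using insert.hyps(2) sum_list_in_partial_sums[of \<beta>] \<beta>(2) by (metis gr0I insertE)
      then show ?thesis
        using \<beta> by (intro bexI[of _ "\<beta> @ [b - sum_list \<beta>]"]) (auto simp: partial_sums_snoc)
    qed
  qed
  from this[OF assms(1)] show ?thesis
    using assms(2) by (simp add: insert_absorb)
qed

section \<open>Refinement and reversal\<close>

lemma partial_sums_conv_D: "partial_sums \<beta> = insert 0 (insert (sum_list \<beta>) (D \<beta>))"
proof -
  have "{..length \<beta>} = insert 0 (insert (length \<beta>) {1..<length \<beta>})"
    by auto
  then show ?thesis
    by (auto simp: partial_sums_def D_def image_iff)
qed

lemma D_pos: "\<beta> \<in> Comp \<Longrightarrow> x \<in> D \<beta> \<Longrightarrow> 0 < x"
  by (cases \<beta>) (auto simp: D_def Comp_def take_Cons')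

lemma D_less:
  assumes "\<beta> \<in> Comp" "x \<in> D \<beta>"
  shows "x < sum_list \<beta>"
proof -
  from assms(2) obtain i where i: "i < length \<beta>" "x = sum_list (take i \<beta>)"
    by (auto simp: D_def)
  have "sum_list \<beta> = x + (\<beta> ! i + sum_list (drop (Suc i) \<beta>))"
    using i by (metis id_take_nth_drop sum_list.Cons sum_list_append)
  moreover have "0 < \<beta> ! i"
    using assms(1) i by (simp add: Comp_def)
  ultimately show ?thesis by linarith
qed

text \<open>
  The partial sums in \<^const>\<open>D\<close> lie strictly between \<open>0\<close> and the size, so adjoining these two
  endpoints on both sides does not affect an inclusion.
\<close>
lemma D_subset_iff_partial_sums:
  assumes "\<beta> \<in> Comp" "sum_list \<beta> = sum_list \<alpha>"
  shows "D \<beta> \<subseteq> D \<alpha> \<longleftrightarrow> partial_sums \<beta> \<subseteq> partial_sums \<alpha>"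
  using D_pos[OF assms(1)] D_less[OF assms(1)] assms(2)
  unfolding partial_sums_conv_D by fastforce

lemma partial_sums_rev: "partial_sums (rev \<beta>) = (\<lambda>x. sum_list \<beta> - x) ` partial_sums \<beta>"
proof -
  have *: "sum_list (take i (rev \<beta>)) = sum_list \<beta> - sum_list (take (length \<beta> - i) \<beta>)" for i
    using sum_list_append[of "take (length \<beta> - i) \<beta>" "drop (length \<beta> - i) \<beta>"]
    by (simp add: take_rev)
  have "bij_betw (\<lambda>i. length \<beta> - i) {..length \<beta>} {..length \<beta>}"
    by (rule bij_betw_byWitness[of _ "\<lambda>i. length \<beta> - i"]) auto
  then have "(\<lambda>i. length \<beta> - i) ` {..length \<beta>} = {..length \<beta>}"
    by (rule bij_betw_imp_surj_on)
  then show ?thesis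
    unfolding partial_sums_def length_rev * by (metis (no_types, lifting) image_cong image_image)
qed

text \<open>
  The reflection is an involution, so it can be moved to the other side of an inclusion. Applied
  to the formula for the antipode, it turns the condition on \<open>\<gamma>\<close> into a lower bound for the
  set of partial sums of \<open>\<beta>\<close>.
\<close>
lemma partial_sums_rev_subset_iff:
  assumes "sum_list \<beta> = sum_list \<gamma>"
  shows "partial_sums \<gamma> \<subseteq> partial_sums (rev \<beta>) \<longleftrightarrow> partial_sums (rev \<gamma>) \<subseteq> partial_sums \<beta>"
proof -
  have "partial_sums (rev \<gamma>) \<subseteq> partial_sums (rev \<beta>)"
    if "partial_sums \<gamma> \<subseteq> partial_sums \<beta>" "sum_list \<beta> = sum_list \<gamma>" for \<beta> \<gamma>
    unfolding partial_sums_rev that(2) using that(1) by (rule image_mono)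
  from this[of \<gamma> "rev \<beta>"] this[of "rev \<gamma>" \<beta>] assms show ?thesis
    by auto
qed

section \<open>The binomial sum over an interval of sets\<close>

text \<open>
  The binomial theorem with the subsets of each size listed one by one. Each further element is
  either left out or contributes a factor \<open>x\<close>, which multiplies the sum by \<open>1 + x\<close>.
\<close>
lemma sum_power_card_Pow:
  fixes x :: "'k::{comm_ring, comm_monoid_mult}"
  assumes "finite U"
  shows "(\<Sum>T\<in>Pow U. x ^ card T) = (1 + x) ^ card U"
  using assms
proof (induction U rule: finite_induct)
  case (insert u U)
  have inj: "inj_on (insert u) (Pow U)"
    using insert.hyps(2) by (auto simp: inj_on_def)
  have card: "card (insert u T) = Suc (card T)" if "T \<in> Pow U" for T
    using that insert.hyps finite_subset by (intro card_insert_disjoint) auto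
  have "(\<Sum>T\<in>Pow (insert u U). x ^ card T)
      = (\<Sum>T\<in>Pow U. x ^ card T) + (\<Sum>T\<in>insert u ` Pow U. x ^ card T)"
    unfolding Pow_insert using insert.hyps by (intro sum.union_disjoint) auto
  also have "(\<Sum>T\<in>insert u ` Pow U. x ^ card T) = x * (\<Sum>T\<in>Pow U. x ^ card T)"
    using inj card by (simp add: sum.reindex sum_distrib_left)
  finally show ?case
    using insert by (simp add: distrib_right)
qed simp

text \<open>A set in the interval is \<open>C\<close> together with an arbitrary subset of \<open>A - C\<close>.\<close>
lemma sum_power_card_between:
  fixes x :: "'k::{comm_ring, comm_monoid_mult}"
  assumes "finite A" "C \<subseteq> A"
  shows "(\<Sum>B\<in>{B. C \<subseteq> B \<and> B \<subseteq> A}. x ^ card B) = x ^ card C * (1 + x) ^ card (A - C)"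
proof -
  have "(\<Sum>B\<in>{B. C \<subseteq> B \<and> B \<subseteq> A}. x ^ card B) = (\<Sum>T\<in>Pow (A - C). x ^ card (C \<union> T))"
    using assms(2)
    by (intro sum.reindex_bij_witness[of _ "\<lambda>T. C \<union> T" "\<lambda>B. B - C"])
       (auto intro!: arg_cong[where f = "\<lambda>B. x ^ card B"])
  also have "\<dots> = (\<Sum>T\<in>Pow (A - C). x ^ card C * x ^ card T)"
  proof (rule sum.cong)
    fix T assume "T \<in> Pow (A - C)"
    then have "card (C \<union> T) = card C + card T"
      using assms finite_subset[of C A] finite_subset[of T A] by (intro card_Un_disjoint) auto
    then show "x ^ card (C \<union> T) = x ^ card C * x ^ card T"
      by (simp add: power_add)
  qed simp
  also have "\<dots> = x ^ card C * (1 + x) ^ card (A - C)"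
    using assms(1) by (simp add: sum_power_card_Pow flip: sum_distrib_left)
  finally show ?thesis .
qed

text \<open>
  The preceding sum carried over to compositions. The partial sum \<open>0\<close> is removed from every
  set, so that the cardinality is exactly the length. (With it the formula would carry an extra
  factor \<open>x\<close> on both sides, which need not be cancellable.)
\<close>
lemma sum_power_length_between:
  fixes x :: "'k::{comm_ring, comm_monoid_mult}"
  assumes "\<alpha> \<in> Comp" "\<gamma> \<in> Comp" "partial_sums \<gamma> \<subseteq> partial_sums \<alpha>"
  shows "(\<Sum>\<beta>\<in>{\<beta> \<in> Comp. partial_sums \<gamma> \<subseteq> partial_sums \<beta> \<and> partial_sums \<beta> \<subseteq> partial_sums \<alpha>}.
      x ^ length \<beta>) = x ^ length \<gamma> * (1 + x) ^ (length \<alpha> - length \<gamma>)"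
    (is "sum _ ?S = _")
proof -
  let ?P = "\<lambda>\<beta>. partial_sums \<beta> - {0}"
  have card: "card (?P \<beta>) = length \<beta>" if "\<beta> \<in> Comp" for \<beta>
    using that by (simp add: card_partial_sums)
  have bij: "bij_betw ?P ?S {B. ?P \<gamma> \<subseteq> B \<and> B \<subseteq> ?P \<alpha>}"
    unfolding bij_betw_def
  proof (intro conjI equalityI subsetI)
    show "inj_on ?P ?S"
    proof (rule inj_onI)
      fix \<beta> \<delta> assume "\<beta> \<in> ?S" "\<delta> \<in> ?S" "?P \<beta> = ?P \<delta>"
      then show "\<beta> = \<delta>"
        by (metis (no_types, lifting) insert_Diff mem_Collect_eq partial_sums_inj
            zero_in_partial_sums)
    qed
  next
    fix B assume B: "B \<in> {B. ?P \<gamma> \<subseteq> B \<and> B \<subseteq> ?P \<alpha>}"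
    then have "finite (insert 0 B)"
      using finite_subset[of B "partial_sums \<alpha>"] by auto
    then obtain \<beta> where \<beta>: "\<beta> \<in> Comp" "partial_sums \<beta> = insert 0 B"
      using partial_sums_surj[of "insert 0 B"] by auto
    have "?P \<beta> = B"
      using B \<beta>(2) by auto
    moreover have "\<beta> \<in> ?S"
      using B \<beta> by auto
    ultimately show "B \<in> ?P ` ?S" by blast
  qed auto
  have "(\<Sum>\<beta>\<in>?S. x ^ length \<beta>) = (\<Sum>\<beta>\<in>?S. x ^ card (?P \<beta>))"
    by (intro sum.cong refl) (simp add: card_partial_sums)
  also have "\<dots> = (\<Sum>B\<in>{B. ?P \<gamma> \<subseteq> B \<and> B \<subseteq> ?P \<alpha>}. x ^ card B)"
    by (rule sum.reindex_bij_betw[OF bij])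
  also have "\<dots> = x ^ card (?P \<gamma>) * (1 + x) ^ card (?P \<alpha> - ?P \<gamma>)"
    using assms(3) by (intro sum_power_card_between) auto
  also have "card (?P \<alpha> - ?P \<gamma>) = card (?P \<alpha>) - card (?P \<gamma>)"
    using assms(3) by (intro card_Diff_subset) auto
  also have "\<dots> = length \<alpha> - length \<gamma>"
    by (simp only: card assms(1,2))
  also have "card (?P \<gamma>) = length \<gamma>"
    by (rule card[OF assms(2)])
  finally show ?thesis .
qed

section \<open>Coordinates in the monomial basis\<close>

lemma QSym_eqI:
  assumes "f \<in> QSym" "g \<in> QSym" "\<And>\<gamma>. \<gamma> \<in> Comp \<Longrightarrow> M_coeff f \<gamma> = M_coeff g \<gamma>"
  shows "f = g"
proof (rule ext)
  fix \<mu>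
  obtain "is" \<beta> where *: "\<beta> \<in> Comp" "is \<in> incr_seqs (length \<beta>)" "\<mu> = expo is \<beta>"
    by (rule expo_surj)
  have "h \<mu> = M_coeff h \<beta>" if "h \<in> QSym" for h
    unfolding M_coeff_def *(3) by (rule QSym_expo[OF that *(1,2) upt_incr])
  then show "f \<mu> = g \<mu>"
    using assms *(1) by metis
qed

lemma M_coeff_scale: "M_coeff (c \<odot> f) \<gamma> = c * M_coeff f \<gamma>"
  by (simp add: M_coeff_def)

lemma M_coeff_sum: "M_coeff (\<Sum>a\<in>A. f a) \<gamma> = (\<Sum>a\<in>A. M_coeff (f a) \<gamma>)"
  by (simp add: M_coeff_def sum_fun_apply)

lemma M_coeff_sum_M:
  assumes "finite A" "A \<subseteq> Comp" "\<gamma> \<in> Comp"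
  shows "M_coeff (\<Sum>\<beta>\<in>A. c \<beta> \<odot> M \<beta>) \<gamma> = (if \<gamma> \<in> A then c \<gamma> else 0)"
proof -
  have "M_coeff (\<Sum>\<beta>\<in>A. c \<beta> \<odot> M \<beta>) \<gamma> = (\<Sum>\<beta>\<in>A. if \<beta> = \<gamma> then c \<beta> else 0)"
    unfolding M_coeff_sum M_coeff_scale
    using assms by (intro sum.cong) (auto simp: M_coeff_M)
  then show ?thesis
    using assms(1) by simp
qed

definition coarsenings :: "nat list \<Rightarrow> nat list set" where
  "coarsenings \<alpha> = {\<beta> \<in> Comp_of_size (sum_list \<alpha>). D \<beta> \<subseteq> D \<alpha>}"

lemma finite_coarsenings [simp]: "finite (coarsenings \<alpha>)"
  by (simp add: coarsenings_def finite_Comp_of_size)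

lemma coarsenings_subset_Comp: "coarsenings \<alpha> \<subseteq> Comp"
  by (auto simp: coarsenings_def Comp_of_size_def)

lemma mem_coarsenings_iff:
  "\<beta> \<in> coarsenings \<alpha> \<longleftrightarrow>
    \<beta> \<in> Comp \<and> sum_list \<beta> = sum_list \<alpha> \<and> partial_sums \<beta> \<subseteq> partial_sums \<alpha>"
  unfolding coarsenings_def Comp_of_size_def using D_subset_iff_partial_sums by blast

lemma mem_coarsenings_rev_iff:
  "\<gamma> \<in> coarsenings (rev \<beta>) \<longleftrightarrow>
    \<gamma> \<in> Comp \<and> sum_list \<gamma> = sum_list \<beta> \<and> partial_sums (rev \<gamma>) \<subseteq> partial_sums \<beta>"
  using partial_sums_rev_subset_iff[of \<beta> \<gamma>] by (auto simp: mem_coarsenings_iff)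

lemma M_coeff_\<eta>:
  "\<gamma> \<in> Comp \<Longrightarrow> M_coeff (\<eta> c \<alpha>) \<gamma> = (if \<gamma> \<in> coarsenings \<alpha> then (c + 1) ^ length \<gamma> else 0)"
  unfolding \<eta>_def coarsenings_def[symmetric]
  by (rule M_coeff_sum_M[OF finite_coarsenings coarsenings_subset_Comp])

lemma M_coeff_antipode_M:
  assumes "\<gamma> \<in> Comp"
  shows "M_coeff (antipode_M \<beta> :: 'k::{comm_ring, comm_monoid_mult} power_series) \<gamma>
      = (if \<gamma> \<in> coarsenings (rev \<beta>) then (- 1) ^ length \<beta> else 0)"
proof -
  have "antipode_M \<beta> = (- 1) ^ length \<beta> \<odot> (\<Sum>\<gamma>\<in>coarsenings (rev \<beta>). (1 :: 'k) \<odot> M \<gamma>)"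
    by (simp add: antipode_M_def coarsenings_def scale_def)
  then show ?thesis
    using M_coeff_sum_M[OF finite_coarsenings coarsenings_subset_Comp assms, of "\<lambda>_. 1 :: 'k"]
    by (simp add: M_coeff_scale)
qed

text \<open>
  The sign \<open>(-1)^length \<beta>\<close> of the antipode merges with the coefficient
  \<open>(c + 1)^length \<beta>\<close> of \<open>\<eta>\<close>, so that each \<open>\<beta>\<close> contributes a single power.
\<close>
lemma M_coeff_antipode_\<eta>:
  fixes c :: "'k::{comm_ring, comm_monoid_mult}"
  assumes "\<gamma> \<in> Comp"
  shows "M_coeff (antipode (\<eta> c \<alpha>)) \<gamma>
      = (\<Sum>\<beta>\<in>{\<beta> \<in> coarsenings \<alpha>. \<gamma> \<in> coarsenings (rev \<beta>)}. (- (c + 1)) ^ length \<beta>)"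
proof -
  have "antipode (\<eta> c \<alpha>) = (\<Sum>\<beta>\<in>coarsenings \<alpha>. M_coeff (\<eta> c \<alpha>) \<beta> \<odot> antipode_M \<beta>)"
    by (rule antipode_eq_sum[OF finite_coarsenings coarsenings_subset_Comp])
       (auto simp: M_coeff_\<eta> split: if_splits)
  then have "M_coeff (antipode (\<eta> c \<alpha>)) \<gamma>
      = (\<Sum>\<beta>\<in>coarsenings \<alpha>. M_coeff (\<eta> c \<alpha>) \<beta> * M_coeff (antipode_M \<beta>) \<gamma>)"
    by (simp only: M_coeff_sum M_coeff_scale)
  also have "\<dots> = (\<Sum>\<beta>\<in>coarsenings \<alpha>.
      if \<gamma> \<in> coarsenings (rev \<beta>) then (- (c + 1)) ^ length \<beta> else 0)"
  proof (rule sum.cong)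
    fix \<beta> assume \<beta>: "\<beta> \<in> coarsenings \<alpha>"
    have "(- (c + 1)) ^ length \<beta> = ((c + 1) * (- 1)) ^ length \<beta>"
      by (simp only: mult_minus_right mult_1_right)
    also have "\<dots> = (c + 1) ^ length \<beta> * (- 1) ^ length \<beta>"
      by (rule power_mult_distrib)
    finally show "M_coeff (\<eta> c \<alpha>) \<beta> * M_coeff (antipode_M \<beta>) \<gamma>
        = (if \<gamma> \<in> coarsenings (rev \<beta>) then (- (c + 1)) ^ length \<beta> else 0)"
      using \<beta> coarsenings_subset_Comp[of \<alpha>] assms
      by (auto simp: M_coeff_\<eta> M_coeff_antipode_M)
  qed simp
  also have "\<dots> = (\<Sum>\<beta>\<in>{\<beta> \<in> coarsenings \<alpha>. \<gamma> \<in> coarsenings (rev \<beta>)}. (- (c + 1)) ^ length \<beta>)"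
    by (rule sum.inter_filter[symmetric]) simp
  finally show ?thesis .
qed

section \<open>The antipode of \<open>\<eta>\<close>\<close>

theorem theorem3p15:
  fixes p q :: "'k::{comm_ring, comm_monoid_mult}" and \<alpha> :: "nat list"
  assumes "p * q = 1"
    and "\<alpha> \<in> Comp"
  shows "antipode (\<eta> q \<alpha>) = (- q) ^ length \<alpha> \<odot> \<eta> p (rev \<alpha>)"
proof (rule QSym_eqI)
  fix \<gamma> :: "nat list" assume \<gamma>: "\<gamma> \<in> Comp"
  let ?S = "{\<beta> \<in> coarsenings \<alpha>. \<gamma> \<in> coarsenings (rev \<beta>)}"
  have coeff: "(\<Sum>\<beta>\<in>?S. (- (q + 1)) ^ length \<beta>)
      = (if \<gamma> \<in> coarsenings (rev \<alpha>) then (- q) ^ length \<alpha> * (p + 1) ^ length \<gamma> else 0)"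
  proof (cases "\<gamma> \<in> coarsenings (rev \<alpha>)")
    case True
    then have size: "sum_list \<gamma> = sum_list \<alpha>"
      and sub: "partial_sums (rev \<gamma>) \<subseteq> partial_sums \<alpha>"
      by (simp_all add: mem_coarsenings_rev_iff)
    have le: "length \<gamma> \<le> length \<alpha>"
      using card_mono[OF finite_partial_sums sub] \<gamma> assms(2) by (simp add: card_partial_sums)
    \<comment> \<open>Compositions of other sizes drop out by themselves, since the size is the largest
      partial sum.\<close>
    have same_size: "sum_list \<beta> = sum_list \<alpha>"
      if "partial_sums (rev \<gamma>) \<subseteq> partial_sums \<beta>" "partial_sums \<beta> \<subseteq> partial_sums \<alpha>" for \<beta>
    proof (rule antisym)
      show "sum_list \<beta> \<le> sum_list \<alpha>"
        using that(2) sum_list_in_partial_sums by (intro partial_sums_le) blast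
      have "sum_list (rev \<gamma>) \<in> partial_sums \<beta>"
        using that(1) sum_list_in_partial_sums by blast
      then show "sum_list \<alpha> \<le> sum_list \<beta>"
        using partial_sums_le size by simp
    qed
    have S: "?S = {\<beta> \<in> Comp. partial_sums (rev \<gamma>) \<subseteq> partial_sums \<beta> \<and>
        partial_sums \<beta> \<subseteq> partial_sums \<alpha>}"
      unfolding mem_coarsenings_rev_iff mem_coarsenings_iff[of _ \<alpha>]
      using \<gamma> size same_size by (intro Collect_cong) metis
    \<comment> \<open>The relation between \<open>p\<close> and \<open>q\<close> splits off one factor \<open>-q\<close> for each part of
      \<open>\<gamma>\<close>. These complete the power from the binomial sum to the exponent \<open>length \<alpha>\<close>.\<close>
    have pq: "- (q + 1) = (- q) * (p + 1)"
      using assms(1) by (simp add: distrib_left mult.commute)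
    have "(\<Sum>\<beta>\<in>?S. (- (q + 1)) ^ length \<beta>)
        = (- (q + 1)) ^ length \<gamma> * (1 + - (q + 1)) ^ (length \<alpha> - length \<gamma>)"
      unfolding S using sum_power_length_between[OF assms(2) _ sub, of "- (q + 1)"] \<gamma>
      by (simp only: rev_in_Comp length_rev)
    also have "1 + - (q + 1) = - q"
      by simp
    also have "(- (q + 1)) ^ length \<gamma> = (- q) ^ length \<gamma> * (p + 1) ^ length \<gamma>"
      unfolding pq by (rule power_mult_distrib)
    also have "(- q) ^ length \<gamma> * (p + 1) ^ length \<gamma> * (- q) ^ (length \<alpha> - length \<gamma>)
        = (- q) ^ (length \<gamma> + (length \<alpha> - length \<gamma>)) * (p + 1) ^ length \<gamma>"
      by (simp only: power_add ac_simps)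
    finally show ?thesis
      using True le by simp
  next
    case False
    then have "?S = {}"
      unfolding mem_coarsenings_rev_iff mem_coarsenings_iff[of _ \<alpha>] by auto
    then show ?thesis
      using False by (simp only: sum.empty if_False)
  qed
  show "M_coeff (antipode (\<eta> q \<alpha>)) \<gamma> = M_coeff ((- q) ^ length \<alpha> \<odot> \<eta> p (rev \<alpha>)) \<gamma>"
    unfolding M_coeff_antipode_\<eta>[OF \<gamma>] coeff M_coeff_scale M_coeff_\<eta>[OF \<gamma>] by simp
qed (intro antipode_in_QSym QSym_scale \<eta>_in_QSym)+

end
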